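(* Let $(\Omega,\Sigma,\mu)$ be a $\sigma$-finite measure space, $\mathcal{A}\subseteq\Sigma$ a $\sigma$-subalgebra such that $(\Omega,\mathcal{A},\mu)$ is $\sigma$-finite, $E=E^{\mathcal{A}}$ the conditional expectation, and write $\Omega=\left(\bigcup_{n}A_n\right)\cup B$ where $\{A_n\}$ is a countable collection of pairwise disjoint $\mathcal{A}$-atoms and $B\in\mathcal{A}$, disjoint from each $A_n$, is non-atomic (with respect to $\mathcal{A}$). Let $1<p<q<\infty$, let $p',q'$ be the conjugate exponents ($\frac1p+\frac1{p'}=1$, $\frac1q+\frac1{q'}=1$), let $u$ be a $\Sigma$-measurable function on $\Omega$, and let $R_u:\mathcal{D}\subseteq L^{p}(\Sigma)\to L^{q}(\Sigma)$, $R_u(f)=E(uf)$, be well defined. Then the operator $R_u$ from $L^{p}(\Sigma)$ into $L^{q}(\Sigma)$ is bounded if and only if both of the following hold: (i) $E(|u|^{p'})=0$ on $B$; (ii) $\displaystyle\sup_{n}\frac{E(|u|^{p'})(A_n)}{\mu(A_n)^{\frac{p'}{q'}-1}}<\infty$. In addition, there is no non-zero bounded operator of the form $R_u$ from $L^p(\Sigma)$ into $L^q(\Sigma)$ ($1<p<q<\infty$) when the underlying measure space $(\Omega,\Sigma,\mu)$ is non-atomic. In particular, if $\mathcal{A}=\Sigma$, then $E=I$, and so the multiplication operator $M_u:f\mapsto uf$ from $L^{p}(\Sigma)$ into $L^{q}(\Sigma)$ is bounded if and only if (i) $u=0$ on $B$; (ii) $\displaystyle\sup_{n}\frac{|u(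A_n)|}{\mu(A_n)^{\frac{1}{q'}-\frac{1}{p'}}}<\infty$.
   Context: $E(f)=E^{\mathcal{A}}(f)$ is the a.e. unique $\mathcal{A}$-measurable function with $\int_A f\,d\mu=\int_A E(f)\,d\mu$ for all $A\in\mathcal{A}$; it is defined for all non-negative measurable $f$ and for $f$ in $L^1(\Sigma)$ and $L^\infty(\Sigma)$, and hence on interpolation spaces of these such as $L^p(\Sigma)$. A measurable function $f$ is called conditionable if $E(f)$ is defined. An $\mathcal{A}$-atom is a set $A\in\mathcal{A}$ with $\mu(A)>0$ such that each $F\in\mathcal{A}$ with $F\subseteq A$ has $\mu(F)=0$ or $\mu(F)=\mu(A)$; a measure space with no atoms is called non-atomic. An $\mathcal{A}$-measurable function $g$ is a.e. constant on an $\mathcal{A}$-atom $A_n$, and $g(A_n)$ denotes this constant. The operator $R_u:\mathcal{D}\to L^{q}(\Sigma)$, $R_u(f)=E(uf)$, is well defined on the linear subspace $\mathcal{D}\subseteq L^p(\Sigma)$ if for all $f\in\mathcal{D}$, $uf$ is conditionable and $E(uf)\in L^{q}(\Sigma)$.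
   Formalization: The claim that no non-zero bounded R_u exists is stated for (Ω,𝒜,μ) non-atomic instead of (Ω,Σ,μ): on [0,1] with Lebesgue measure, 𝒜 trivial and u=1, R_u f=∫f is non-zero and bounded although Σ is non-atomic. *)

theory Defs
  imports "HOL-Probability.Conditional_Expectation"
begin

text \<open>
  A scalar type of sort \<open>{real_normed_field, euclidean_space}\<close> stands for the real or the
  complex field, so that both kinds of \<open>L\<^sup>p\<close> spaces are covered. Elements of \<open>L\<^sup>p\<close> are
  represented by functions; a.e. equal functions are not identified.
\<close>

definition Lp_space :: "'a measure \<Rightarrow> real \<Rightarrow> ('a \<Rightarrow> 'k::euclidean_space) set" where
  "Lp_space M p = {f \<in> borel_measurable M. integrable M (\<lambda>x. norm (f x) powr p)}"

definition Lp_norm :: "'a measure \<Rightarrow> real \<Rightarrow> ('a \<Rightarrow> 'k::euclidean_space) \<Rightarrow> real" where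
  "Lp_norm M p f = (\<integral>x. norm (f x) powr p \<partial>M) powr (1 / p)"

definition fun_subspace :: "('a \<Rightarrow> 'k::field) set \<Rightarrow> bool" where
  "fun_subspace D \<longleftrightarrow> (\<lambda>_. 0) \<in> D
     \<and> (\<forall>f\<in>D. \<forall>g\<in>D. (\<lambda>x. f x + g x) \<in> D)
     \<and> (\<forall>c. \<forall>f\<in>D. (\<lambda>x. c * f x) \<in> D)"

definition is_atom :: "'a measure \<Rightarrow> 'a set \<Rightarrow> bool" where
  "is_atom M A \<longleftrightarrow> A \<in> sets M \<and> emeasure M A > 0
     \<and> (\<forall>S\<in>sets M. S \<subseteq> A \<longrightarrow> emeasure M S = 0 \<or> emeasure M S = emeasure M A)"

definition nonatomic :: "'a measure \<Rightarrow> bool" where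
  "nonatomic M \<longleftrightarrow> (\<nexists>A. is_atom M A)"

definition atom_value :: "'a measure \<Rightarrow> 'a set \<Rightarrow> ('a \<Rightarrow> 'b) \<Rightarrow> 'b" where
  "atom_value M A g = (THE c. AE x in M. x \<in> A \<longrightarrow> g x = c)"

text \<open>
  The conditional expectation is taken coordinatewise, i.e. on real and imaginary parts in the
  complex case; see the two lemmas below.
\<close>

definition cond_exp :: "'a measure \<Rightarrow> 'a measure \<Rightarrow> ('a \<Rightarrow> 'k::euclidean_space) \<Rightarrow> 'a \<Rightarrow> 'k" where
  "cond_exp M F f = (\<lambda>x. \<Sum>b\<in>Basis. real_cond_exp M F (\<lambda>y. f y \<bullet> b) x *\<^sub>R b)"

lemma cond_exp_real: "cond_exp M F f = real_cond_exp M F f"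
  by (simp add: cond_exp_def)

lemma cond_exp_complex:
  "cond_exp M F f = (\<lambda>x. Complex (real_cond_exp M F (\<lambda>y. Re (f y)) x)
                                  (real_cond_exp M F (\<lambda>y. Im (f y)) x))"
  by (simp add: cond_exp_def Basis_complex_def complex_eq_iff fun_eq_iff)

text \<open>
  \<open>f\<close> is conditionable when \<open>E(|f|)\<close> is finite a.e. Since the subalgebra is sigma-finite, this
  covers \<open>L\<^sup>1\<close>, \<open>L\<^sup>\<infinity>\<close> and everything in between. Non-negative functions whose conditional
  expectation is infinite on a set of positive measure are left out: they could not satisfy
  \<open>E(f) \<in> L\<^sup>q\<close> anyway, whereas \<open>real_cond_exp\<close> would return the value 0 in place of \<open>\<infinity>\<close>.
\<close>

definition conditionable :: "'a measure \<Rightarrow> 'a measure \<Rightarrow> ('a \<Rightarrow> 'k::euclidean_space) \<Rightarrow> bool" where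
  "conditionable M F f \<longleftrightarrow> f \<in> borel_measurable M
     \<and> (AE x in M. nn_cond_exp M F (\<lambda>y. ennreal (norm (f y))) x < \<infinity>)"

definition R_op :: "'a measure \<Rightarrow> 'a measure \<Rightarrow> ('a \<Rightarrow> 'k) \<Rightarrow> ('a \<Rightarrow> 'k)
    \<Rightarrow> 'a \<Rightarrow> 'k::{real_normed_field, euclidean_space}" where
  "R_op M F u f = cond_exp M F (\<lambda>x. u x * f x)"

definition R_well_defined :: "'a measure \<Rightarrow> 'a measure \<Rightarrow> real
    \<Rightarrow> ('a \<Rightarrow> 'k::{real_normed_field, euclidean_space}) \<Rightarrow> ('a \<Rightarrow> 'k) set \<Rightarrow> bool" where
  "R_well_defined M F q u D \<longleftrightarrow>
     (\<forall>f\<in>D. conditionable M F (\<lambda>x. u x * f x) \<and> R_op M F u f \<in> Lp_space M q)"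

definition bounded_Lp_Lq :: "'a measure \<Rightarrow> real \<Rightarrow> real
    \<Rightarrow> (('a \<Rightarrow> 'k::euclidean_space) \<Rightarrow> 'a \<Rightarrow> 'k) \<Rightarrow> bool" where
  "bounded_Lp_Lq M p q T \<longleftrightarrow> (\<forall>f\<in>Lp_space M p. T f \<in> Lp_space M q)
     \<and> (\<exists>C. \<forall>f\<in>Lp_space M p. Lp_norm M q (T f) \<le> C * Lp_norm M p f)"

definition R_bounded :: "'a measure \<Rightarrow> 'a measure \<Rightarrow> real \<Rightarrow> real
    \<Rightarrow> ('a \<Rightarrow> 'k::{real_normed_field, euclidean_space}) \<Rightarrow> bool" where
  "R_bounded M F p q u \<longleftrightarrow>
     R_well_defined M F q u (Lp_space M p) \<and> bounded_Lp_Lq M p q (R_op M F u)"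

definition R_nonzero :: "'a measure \<Rightarrow> 'a measure \<Rightarrow> real
    \<Rightarrow> ('a \<Rightarrow> 'k::{real_normed_field, euclidean_space}) \<Rightarrow> bool" where
  "R_nonzero M F p u \<longleftrightarrow> (\<exists>f\<in>Lp_space M p. \<not> (AE x in M. R_op M F u f x = 0))"

text \<open>
  That there is no non-zero bounded \<open>R_op M F u\<close> requires the measure restricted to the subalgebra
  \<open>F\<close> to be non-atomic. Non-atomicity of \<open>M\<close> is weaker and does not suffice: on \<open>[0,1]\<close> with
  Lebesgue measure and the trivial subalgebra, \<open>R_op M F 1 f\<close> is the constant \<open>\<integral>f\<close>, which
  is bounded from \<open>L\<^sup>p\<close> into \<open>L\<^sup>q\<close>.
\<close>

end

theory Submission
  imports Defs
begin

text \<open>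
  Put \<open>\<nu>(S) = \<integral>\<^sub>S |u|\<^sup>p\<^sup>'\<close> for \<open>S \<in> F\<close>. Testing boundedness of \<open>R\<^sub>u\<close> on truncations of \<open>|u|\<^sup>p\<^sup>'/u\<close> on \<open>S\<close>
  gives \<open>\<nu>(S) \<le> K \<mu>(S)\<^sup>s\<close> with \<open>s = p'/q' > 1\<close>. For atoms this is condition (ii). On the non-atomic
  part there are sets of arbitrarily small measure inside every \<open>{E(|u|\<^sup>p\<^sup>') > \<epsilon>}\<close> of positive
  measure, on which \<open>\<epsilon> \<mu>(S) \<le> \<nu>(S) \<le> K \<mu>(S)\<^sup>s\<close> fails; this forces (i). Conversely, Hoelder's
  inequality on each atom gives the pointwise bound
  \<open>|R\<^sub>u f|\<^sup>q \<le> L (\<integral>|f|\<^sup>p)\<^bsup>q/p-1\<^esup> E(|f|\<^sup>p)\<close>, which integrates to boundedness.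
\<close>

section \<open>Conjugate exponents and Hoelder's inequality\<close>

lemma conjugate_exponent_gt_1:
  fixes p q :: real
  assumes "1 < p" "1 / p + 1 / q = 1"
  shows "1 < q"
proof -
  have "1 / q = 1 - 1 / p" using assms by simp
  moreover have "0 < 1 - 1 / p" "1 - 1 / p < 1" using assms by auto
  ultimately have "0 < 1 / q" "1 / q < 1" by simp_all
  then show ?thesis by (auto simp: divide_simps split: if_splits)
qed

text \<open>Conjugation reverses order, so \<open>p < q\<close> yields \<open>q' < p'\<close>. This
  ratio is the exponent of the set bound on \<nu>, and its exceeding 1 is what makes that bound
  superlinear.\<close>

lemma conjugate_ratio_gt_1:
  fixes p q p' q' :: real
  assumes "1 < p" "p < q" "1 / p + 1 / p' = 1" "1 / q + 1 / q' = 1"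
  shows "1 < p' / q'"
proof -
  have "1 < p'" "1 < q'" using conjugate_exponent_gt_1[of p p'] conjugate_exponent_gt_1[of q q'] assms by auto
  moreover have "1 / q < 1 / p" using assms by (simp add: frac_less2)
  then have "1 / p' < 1 / q'" using assms by linarith
  ultimately show ?thesis by (simp add: field_simps)
qed

text \<open>Young's inequality is applied to \<open>f\<close> and \<open>g\<close> divided by their
  norms and then integrated. If one norm is zero, that factor and hence the product vanishes a.e.
  The left side is an integral in [0, \<infinity>], so finiteness of the integral of the product is
  part of what is obtained.\<close>

lemma Holder_nn_integral:
  fixes f g :: "'a \<Rightarrow> real"
  assumes pq: "1 < p" "1 / p + 1 / q = 1"
    and [measurable]: "f \<in> borel_measurable M" "g \<in> borel_measurable M"
    and pos: "\<And>x. 0 \<le> f x" "\<And>x. 0 \<le> g x"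
    and int: "integrable M (\<lambda>x. f x powr p)" "integrable M (\<lambda>x. g x powr q)"
  shows "(\<integral>\<^sup>+x. ennreal (f x * g x) \<partial>M)
    \<le> ennreal ((\<integral>x. f x powr p \<partial>M) powr (1 / p) * (\<integral>x. g x powr q \<partial>M) powr (1 / q))"
proof -
  define a where "a = (\<integral>x. f x powr p \<partial>M)"
  define b where "b = (\<integral>x. g x powr q \<partial>M)"
  have q: "1 < q" using conjugate_exponent_gt_1 pq .
  have ab: "0 \<le> a" "0 \<le> b" unfolding a_def b_def by simp_all
  show ?thesis
  proof (cases "a = 0 \<or> b = 0")
    case True
    have "AE x in M. f x * g x = 0"
    proof (cases "a = 0")
      case True
      then have "AE x in M. f x powr p = 0"
        unfolding a_def using int(1) by (subst (asm) integral_nonneg_eq_0_iff_AE) auto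
      then show ?thesis by eventually_elim auto
    next
      case False
      then have "b = 0" using True by simp
      then have "AE x in M. g x powr q = 0"
        unfolding b_def using int(2) by (subst (asm) integral_nonneg_eq_0_iff_AE) auto
      then show ?thesis by eventually_elim auto
    qed
    then have "(\<integral>\<^sup>+x. ennreal (f x * g x) \<partial>M) = (\<integral>\<^sup>+x. 0 \<partial>M)"
      by (intro nn_integral_cong_AE) auto
    then show ?thesis by simp
  next
    case False
    then have ab': "0 < a" "0 < b" using ab by auto
    \<comment> \<open>The product of the two norms. After scaling by \<open>c\<close>, the two
      summands from Young's inequality integrate to \<open>c / p\<close> and \<open>c / q\<close>,
      which add up to \<open>c\<close>.\<close>
    define c where "c = a powr (1 / p) * b powr (1 / q)"
    have c: "0 < c" using ab' by (simp add: c_def)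
    have *: "f x * g x \<le> c * (f x powr p / (p * a) + g x powr q / (q * b))" for x
    proof -
      have "(f x / a powr (1/p)) * (g x / b powr (1/q))
          \<le> (f x / a powr (1/p)) powr p / p + (g x / b powr (1/q)) powr q / q"
        using pq q pos[of x] ab' by (intro Youngs_inequality) auto
      also have "\<dots> = f x powr p / (p * a) + g x powr q / (q * b)"
        using pq q pos[of x] ab' by (simp add: powr_divide powr_powr mult.commute)
      finally have "c * ((f x / a powr (1/p)) * (g x / b powr (1/q)))
          \<le> c * (f x powr p / (p * a) + g x powr q / (q * b))"
        using c by (intro mult_left_mono) auto
      then show ?thesis using ab' by (simp add: c_def)
    qed
    have "(\<integral>\<^sup>+x. ennreal (f x * g x) \<partial>M)
        \<le> (\<integral>\<^sup>+x. ennreal (c * (f x powr p / (p * a) + g x powr q / (q * b))) \<partial>M)"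
      by (intro nn_integral_mono ennreal_leI *)
    also have "\<dots> = ennreal (\<integral>x. c * (f x powr p / (p * a) + g x powr q / (q * b)) \<partial>M)"
      using int c pq q ab' by (intro nn_integral_eq_integral) auto
    also have "(\<integral>x. c * (f x powr p / (p * a) + g x powr q / (q * b)) \<partial>M)
        = c * (a / (p * a) + b / (q * b))"
      using int by (simp add: a_def b_def)
    also have "\<dots> = c" using ab' pq by simp
    finally show ?thesis by (simp add: c_def a_def b_def)
  qed
qed

section \<open>Atoms, small sets in their absence, and superlinear bounds\<close>

text \<open>By sigma-finiteness a set of infinite measure contains one of finite positive measure,
  which the definition of an atom excludes.\<close>

lemma (in sigma_finite_measure) is_atom_finite:
  assumes "is_atom M A"
  shows "emeasure M A < \<infinity>"
proof (rule ccontr)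
  assume "\<not> ?thesis"
  then have inf: "emeasure M A = \<infinity>" by (metis infinity_ennreal_def top.not_eq_extremum)
  have "A \<in> sets M" using assms by (simp add: is_atom_def)
  obtain Z where Z: "Z \<in> sets M" "Z \<subseteq> A" "emeasure M Z < \<infinity>" "emeasure M Z > ennreal 0"
    using approx_PInf_emeasure_with_finite[OF \<open>A \<in> sets M\<close> inf, of 0] by blast
  then show False using assms inf by (auto simp: is_atom_def)
qed

text \<open>For each open set of a countable basis, its preimage in \<open>A\<close> is null or of
  full measure, and in the latter case its complement in \<open>A\<close> is null because
  \<open>A\<close> has finite measure. Off one null set all points of \<open>A\<close> therefore lie
  in the preimages of the same basic sets. Basic sets separate points of the codomain, so
  \<open>g\<close> takes a single value there.\<close>

lemma measurable_AE_const_on_atom: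
  fixes g :: "'a \<Rightarrow> 'b::{second_countable_topology, t2_space}"
  assumes at: "is_atom M A" and fin: "emeasure M A < \<infinity>"
    and g[measurable]: "g \<in> borel_measurable M"
  obtains c where "AE x in M. x \<in> A \<longrightarrow> g x = c"
proof -
  obtain \<B> :: "'b set set" where \<B>: "countable \<B>" "topological_basis \<B>"
    using ex_countable_basis by blast
  have A[measurable]: "A \<in> sets M" and A0: "emeasure M A > 0" using at by (auto simp: is_atom_def)
  have "AE x in M. x \<in> A \<longrightarrow> (g x \<in> b \<longleftrightarrow> emeasure M (A \<inter> g -` b) = emeasure M A)"
    if "b \<in> \<B>" for b
  proof -
    have [measurable]: "b \<in> sets borel" using topological_basis_open[OF \<B>(2) that] by auto
    have eq: "A \<inter> g -` b = {x \<in> space M. x \<in> A \<and> g x \<in> b}"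
      using sets.sets_into_space[OF A] by auto
    have S[measurable]: "A \<inter> g -` b \<in> sets M" unfolding eq by measurable
    consider "emeasure M (A \<inter> g -` b) = 0" | "emeasure M (A \<inter> g -` b) = emeasure M A"
      using at S unfolding is_atom_def by blast
    then show ?thesis
    proof cases
      case 1
      then have "AE x in M. x \<notin> A \<inter> g -` b"
        using S by (intro AE_not_in) auto
      then show ?thesis using 1 A0 by auto
    next
      case 2
      have "emeasure M (A - A \<inter> g -` b) = emeasure M A - emeasure M (A \<inter> g -` b)"
        using fin S by (intro emeasure_Diff) (auto simp: 2)
      then have "emeasure M (A - A \<inter> g -` b) = 0" using 2 fin by simp
      then have "AE x in M. x \<notin> A - A \<inter> g -` b"
        using A S by (intro AE_not_in) auto
      then show ?thesis using 2 by auto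
    qed
  qed
  then have ae: "AE x in M. \<forall>b\<in>\<B>. x \<in> A \<longrightarrow> (g x \<in> b \<longleftrightarrow> emeasure M (A \<inter> g -` b) = emeasure M A)"
    using \<B>(1) by (subst AE_ball_countable) auto
  \<comment> \<open>Some point of \<open>A\<close> must be typical for every basic set, since
    otherwise \<open>A\<close> would be null. Its value under \<open>g\<close> is the
    constant.\<close>
  have "\<exists>x0\<in>A. \<forall>b\<in>\<B>. g x0 \<in> b \<longleftrightarrow> emeasure M (A \<inter> g -` b) = emeasure M A"
  proof (rule ccontr)
    assume "\<not> ?thesis"
    then have "AE x in M. x \<notin> A" using ae by (auto elim!: eventually_mono)
    then have "A \<in> null_sets M" using A by (simp add: AE_iff_null_sets)
    then show False using A0 by auto
  qed
  then obtain x0 where x0: "\<forall>b\<in>\<B>. g x0 \<in> b \<longleftrightarrow> emeasure M (A \<inter> g -` b) = emeasure M A"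
    by blast
  have "AE x in M. x \<in> A \<longrightarrow> g x = g x0"
    using ae
  proof eventually_elim
    case (elim x)
    show ?case
    proof (rule impI, rule ccontr)
      assume x: "x \<in> A" "g x \<noteq> g x0"
      then obtain U where U: "open U" "g x \<in> U" "g x0 \<notin> U" using separation_t1 by blast
      then obtain b where b: "b \<in> \<B>" "g x \<in> b" "b \<subseteq> U"
        using topological_basisE[OF \<B>(2)] by metis
      then show False using x0 elim x U by blast
    qed
  qed
  then show thesis by (rule that)
qed

text \<open>A set of positive measure cannot carry two different a.e. constants, so the description
  in \<open>atom_value\<close> is unique.\<close>

lemma atom_value_eqI:
  assumes "A \<in> sets M" "emeasure M A > 0" "AE x in M. x \<in> A \<longrightarrow> g x = c"
  shows "atom_value M A g = c"
  unfolding atom_value_def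
proof (rule the_equality)
  show "AE x in M. x \<in> A \<longrightarrow> g x = c" by (fact assms(3))
next
  fix d assume "AE x in M. x \<in> A \<longrightarrow> g x = d"
  with assms(3) have ae: "AE x in M. x \<in> A \<longrightarrow> c = d" by eventually_elim auto
  show "d = c"
  proof (rule ccontr)
    assume "d \<noteq> c"
    then have "AE x in M. x \<notin> A" using ae by auto
    then have "A \<in> null_sets M" using assms(1) by (simp add: AE_iff_null_sets)
    then show False using assms(2) by auto
  qed
qed

lemma is_atom_restrict_space:
  assumes B: "B \<in> sets M"
  shows "is_atom (restrict_space M B) S \<longleftrightarrow> is_atom M S \<and> S \<subseteq> B"
proof -
  have s: "T \<in> sets (restrict_space M B) \<longleftrightarrow> T \<in> sets M \<and> T \<subseteq> B" for T
    using B sets.sets_into_space[OF B] by (auto simp: sets_restrict_space_iff)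
  have e: "T \<subseteq> B \<Longrightarrow> emeasure (restrict_space M B) T = emeasure M T" for T
    using B sets.sets_into_space[OF B] by (intro emeasure_restrict_space) (auto simp: Int_absorb2)
  show ?thesis
  proof (cases "S \<subseteq> B")
    case True
    then have "T \<subseteq> S \<Longrightarrow> T \<subseteq> B" "T \<subseteq> S \<Longrightarrow> emeasure (restrict_space M B) T = emeasure M T" for T
      using e by auto
    then show ?thesis using True by (auto simp: is_atom_def s)
  next
    case False
    then show ?thesis by (auto simp: is_atom_def s)
  qed
qed

text \<open>Of the two pieces into which a non-atom splits, the lighter one has at most half the
  measure.\<close>
lemma ex_small_subset_no_atoms:
  assumes "\<And>S. S \<subseteq> A \<Longrightarrow> \<not> is_atom M S"
    and A: "A \<in> sets M" "0 < emeasure M A" "emeasure M A < \<infinity>"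
  shows "\<exists>S\<in>sets M. S \<subseteq> A \<and> 0 < measure M S \<and> measure M S \<le> measure M A / 2 ^ k"
proof (induction k)
  case 0
  have "0 < measure M A" using A by (simp add: measure_def enn2real_positive_iff)
  then show ?case using A by auto
next
  case (Suc k)
  then obtain S where S: "S \<in> sets M" "S \<subseteq> A" "0 < measure M S" "measure M S \<le> measure M A / 2 ^ k"
    by blast
  have Sfin: "emeasure M S < \<infinity>" using emeasure_mono[OF S(2) A(1)] A(3) by (auto intro: le_less_trans)
  have S0: "emeasure M S > 0" using S(3) by (metis emeasure_notin_sets enn2real_positive_iff measure_def)
  from assms(1)[OF S(2)] obtain T where T: "T \<in> sets M" "T \<subseteq> S" "emeasure M T \<noteq> 0"
      "emeasure M T \<noteq> emeasure M S"
    using S(1) S0 by (auto simp: is_atom_def)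
  have Tfin: "emeasure M T < \<infinity>" using emeasure_mono[OF T(2) S(1)] Sfin by (auto intro: le_less_trans)
  have fm: "T \<in> fmeasurable M" "S \<in> fmeasurable M"
    using T S Tfin Sfin by (auto simp: fmeasurable_def)
  have d: "measure M (S - T) = measure M S - measure M T"
    using fm T(2) by (intro measurable_measure_Diff) auto
  have "emeasure M T = ennreal (measure M T)" "emeasure M S = ennreal (measure M S)"
    using Tfin Sfin by (simp_all add: emeasure_eq_ennreal_measure)
  then have m: "0 < measure M T" "measure M T \<noteq> measure M S"
    using T(3,4) by (auto simp: zero_less_measure_iff)
  have "measure M T \<le> measure M S" using fm T(2) by (intro measure_mono_fmeasurable) auto
  then have d0: "0 < measure M (S - T)" using m d by simp
  show ?case
  proof (cases "measure M T \<le> measure M S / 2")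
    case True
    then show ?thesis using m T S by (intro bexI[of _ T]) auto
  next
    case False
    then show ?thesis using d d0 T S by (intro bexI[of _ "S - T"]) auto
  qed
qed

text \<open>If \<open>w\<close> were at least \<epsilon> on a subset of \<open>B\<close> of positive
  measure, halving would give sets \<open>S\<close> inside it with arbitrarily small positive
  measure. On them \<epsilon> times the measure is at most \<open>K\<close> times its power
  \<open>s\<close>, so \<epsilon> is at most \<open>K\<close> times the power \<open>s - 1\<close>,
  which tends to 0.\<close>

lemma (in sigma_finite_measure) superlinear_bound_imp_zero:
  fixes w :: "'a \<Rightarrow> ennreal"
  assumes w[measurable]: "w \<in> borel_measurable M" and B[measurable]: "B \<in> sets M"
    and no_atom: "\<And>S. S \<subseteq> B \<Longrightarrow> \<not> is_atom M S"
    and s: "1 < s" and K: "0 \<le> K"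
    and bound: "\<And>A. A \<in> sets M \<Longrightarrow> emeasure M A < \<infinity> \<Longrightarrow>
      (\<integral>\<^sup>+x\<in>A. w x \<partial>M) \<le> ennreal (K * measure M A powr s)"
  shows "AE x in M. x \<in> B \<longrightarrow> w x = 0"
proof -
  define C where "C k = {x \<in> space M. x \<in> B \<and> ennreal (1 / real (Suc k)) \<le> w x}" for k
  have C[measurable]: "C k \<in> sets M" for k unfolding C_def by measurable
  have null: "emeasure M (C k) = 0" for k
  proof (rule ccontr)
    assume ne: "emeasure M (C k) \<noteq> 0"
    \<comment> \<open>The level set may have infinite measure, while the bound and the halving need
      finite measure; sigma-finiteness supplies a suitable subset.\<close>
    obtain A where A: "A \<in> sets M" "A \<subseteq> C k" "0 < emeasure M A" "emeasure M A < \<infinity>"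
    proof (cases "emeasure M (C k) = \<infinity>")
      case True
      then obtain Z where "Z \<in> sets M" "Z \<subseteq> C k" "emeasure M Z < \<infinity>" "emeasure M Z > ennreal 0"
        using approx_PInf_emeasure_with_finite[OF C True, of 0] by blast
      then show ?thesis by (intro that) auto
    next
      case False
      then show ?thesis
        using ne by (intro that[of "C k"]) (auto simp: zero_less_iff_neq_zero less_top)
    qed
    have AB: "A \<subseteq> B" using A(2) by (auto simp: C_def)
    have le: "1 / real (Suc k) \<le> K * (measure M A / 2 ^ j) powr (s - 1)" for j
    proof -
      have "\<exists>S\<in>sets M. S \<subseteq> A \<and> 0 < measure M S \<and> measure M S \<le> measure M A / 2 ^ j"
        using no_atom AB A by (intro ex_small_subset_no_atoms) auto
      then obtain S where S: "S \<in> sets M" "S \<subseteq> A" "0 < measure M S" "measure M S \<le> measure M A / 2 ^ j"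
        by blast
      have Sfin: "emeasure M S < \<infinity>"
        using emeasure_mono[OF S(2) A(1)] A(4) by (auto intro: le_less_trans)
      have "ennreal (1 / real (Suc k) * measure M S) = ennreal (1 / real (Suc k)) * emeasure M S"
        using Sfin by (simp add: ennreal_mult[symmetric] emeasure_eq_ennreal_measure)
      also have "\<dots> = (\<integral>\<^sup>+x. ennreal (1 / real (Suc k)) * indicator S x \<partial>M)"
        using S(1) by (simp add: nn_integral_cmult_indicator)
      also have "\<dots> \<le> (\<integral>\<^sup>+x\<in>S. w x \<partial>M)"
        using S(2) A(2) by (intro nn_integral_mono) (auto simp: C_def indicator_def)
      also have "\<dots> \<le> ennreal (K * measure M S powr s)" using bound S(1) Sfin by blast
      finally have "1 / real (Suc k) * measure M S \<le> K * measure M S powr s"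
        using K by (subst (asm) ennreal_le_iff) auto
      also have "measure M S powr s = measure M S powr (s - 1) * measure M S"
        using S(3) powr_add[of "measure M S" "s - 1" 1] by simp
      finally have "1 / real (Suc k) * measure M S \<le> (K * measure M S powr (s - 1)) * measure M S"
        by (simp add: mult.assoc)
      then have "1 / real (Suc k) \<le> K * measure M S powr (s - 1)"
        using S(3) mult_right_le_imp_le by blast
      also have "\<dots> \<le> K * (measure M A / 2 ^ j) powr (s - 1)"
        using S s K by (intro mult_left_mono powr_mono2) auto
      finally show ?thesis .
    qed
    \<comment> \<open>Let \<open>j\<close> tend to infinity in \<open>le\<close>: since
      \<open>s - 1\<close> is positive, the right-hand side tends to 0 while the left-hand side is a
      fixed positive number.\<close>
    have "(\<lambda>j. measure M A * (1 / 2) ^ j) \<longlonglongrightarrow> measure M A * 0"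
      by (intro tendsto_mult tendsto_const LIMSEQ_power_zero) simp
    then have "(\<lambda>j. measure M A / 2 ^ j) \<longlonglongrightarrow> 0" by (simp add: power_divide)
    then have "(\<lambda>j. K * (measure M A / 2 ^ j) powr (s - 1)) \<longlonglongrightarrow> K * 0 powr (s - 1)"
      using s by (intro tendsto_mult tendsto_const tendsto_powr2) auto
    then have "1 / real (Suc k) \<le> K * 0 powr (s - 1)"
      by (rule LIMSEQ_le_const) (use le in blast)
    then show False by simp
  qed
  have "AE x in M. \<forall>k. x \<notin> C k"
    unfolding AE_all_countable using null C by (auto intro!: AE_not_in)
  then show ?thesis using AE_space
  proof eventually_elim
    case (elim x)
    show ?case
    proof (intro impI, rule ccontr)
      assume x: "x \<in> B" "w x \<noteq> 0"
      \<comment> \<open>A positive real lower bound for \<open>w x\<close>, also when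
        \<open>w x\<close> is infinite; it places \<open>x\<close> in some level set
        \<open>C k\<close>.\<close>
      obtain r where r: "0 < r" "ennreal r \<le> w x"
      proof (cases "w x")
        case (real r)
        then show ?thesis using x that[of r] by (auto simp: less_le)
      next
        case top
        then show ?thesis using that[of 1] by simp
      qed
      obtain k where "1 / real (Suc k) < r" using r(1) nat_approx_posE by blast
      then have "ennreal (1 / real (Suc k)) \<le> w x" using r(2) by (meson ennreal_leI less_imp_le order_trans)
      then show False using elim x by (auto simp: C_def)
    qed
  qed
qed

section \<open>Conditional expectations on atoms of the subalgebra\<close>

context sigma_finite_subalgebra
begin

lemma set_nn_integral_nn_cond_exp:
  assumes [measurable]: "A \<in> sets F" "g \<in> borel_measurable M"
  shows "(\<integral>\<^sup>+x\<in>A. nn_cond_exp M F g x \<partial>M) = (\<integral>\<^sup>+x\<in>A. g x \<partial>M)"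
  using nn_cond_exp_intg[of "indicator A" g] by (simp add: mult.commute)

lemma is_atom_subalgD:
  assumes "is_atom (restr_to_subalg M F) A"
  shows "A \<in> sets F" "A \<in> sets M" "0 < emeasure M A" "emeasure M A < \<infinity>"
proof -
  interpret r: sigma_finite_measure "restr_to_subalg M F" by (rule sigma_fin_subalg)
  have "emeasure (restr_to_subalg M F) A < \<infinity>" using r.is_atom_finite[OF assms] .
  moreover show A: "A \<in> sets F"
    using assms by (simp add: is_atom_def sets_restr_to_subalg[OF subalg])
  ultimately show "0 < emeasure M A" "emeasure M A < \<infinity>"
    using assms by (simp_all add: is_atom_def emeasure_restr_to_subalg[OF subalg])
  show "A \<in> sets M" using A subalg by (auto simp: subalgebra_def)
qed

text \<open>The conditional expectation is \<open>F\<close>-measurable, hence a.e. constant on an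
  atom of \<open>F\<close>; integrating over the atom identifies the constant as the average of
  \<open>g\<close>.\<close>

lemma nn_cond_exp_on_atom:
  assumes at: "is_atom (restr_to_subalg M F) A" and [measurable]: "g \<in> borel_measurable M"
  shows "AE x in M. x \<in> A \<longrightarrow> nn_cond_exp M F g x = (\<integral>\<^sup>+x\<in>A. g x \<partial>M) / emeasure M A"
proof -
  interpret r: sigma_finite_measure "restr_to_subalg M F" by (rule sigma_fin_subalg)
  note A = is_atom_subalgD[OF at]
  have "nn_cond_exp M F g \<in> borel_measurable (restr_to_subalg M F)"
    by (rule measurable_in_subalg[OF subalg]) simp
  then obtain c where "AE x in restr_to_subalg M F. x \<in> A \<longrightarrow> nn_cond_exp M F g x = c"
    using measurable_AE_const_on_atom[OF at r.is_atom_finite[OF at]] by blast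
  then have c: "AE x in M. x \<in> A \<longrightarrow> nn_cond_exp M F g x = c"
    by (rule AE_restr_to_subalg[OF subalg])
  have "(\<integral>\<^sup>+x\<in>A. g x \<partial>M) = (\<integral>\<^sup>+x\<in>A. nn_cond_exp M F g x \<partial>M)"
    using A by (simp add: set_nn_integral_nn_cond_exp)
  also have "\<dots> = (\<integral>\<^sup>+x. c * indicator A x \<partial>M)"
    using c by (intro nn_integral_cong_AE) (auto elim!: eventually_mono simp: indicator_def)
  also have "\<dots> = c * emeasure M A" using A by (simp add: nn_integral_cmult_indicator)
  finally have "(\<integral>\<^sup>+x\<in>A. g x \<partial>M) / emeasure M A = c"
    using A by (simp add: ennreal_mult_divide_eq)
  then show ?thesis using c by simp
qed

text \<open>Each coordinate of \<open>of_real (h x)\<close> is the fixed multiple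
  \<open>1 \<bullet> b\<close> of \<open>h x\<close>, so linearity applies coordinate by coordinate,
  and the coordinates of \<open>1\<close> reassemble to \<open>1\<close>. For an abstract scalar
  type \<open>1\<close> is not known to be a basis vector, hence the detour.\<close>

lemma cond_exp_of_real:
  fixes h :: "'a \<Rightarrow> real"
  assumes h: "integrable M h"
  shows "AE x in M. cond_exp M F (\<lambda>x. of_real (h x) :: 'k::{real_normed_field, euclidean_space}) x
    = of_real (real_cond_exp M F h x)"
proof -
  have eq: "(of_real (h x) :: 'k) \<bullet> b = (1 \<bullet> b) * h x" for x b
    by (simp add: of_real_def)
  have "AE x in M. \<forall>b\<in>Basis. real_cond_exp M F (\<lambda>x. ((1::'k) \<bullet> b) * h x) x = (1 \<bullet> b) * real_cond_exp M F h x"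
    by (intro AE_finite_allI finite_Basis real_cond_exp_cmult h)
  then show ?thesis
  proof eventually_elim
    case (elim x)
    have "cond_exp M F (\<lambda>x. of_real (h x) :: 'k) x
        = (\<Sum>b\<in>Basis. ((1 \<bullet> b) * real_cond_exp M F h x) *\<^sub>R b)"
      unfolding cond_exp_def eq using elim by (intro sum.cong) auto
    also have "\<dots> = real_cond_exp M F h x *\<^sub>R (\<Sum>b\<in>Basis. ((1::'k) \<bullet> b) *\<^sub>R b)"
      by (simp add: scaleR_sum_right mult.commute)
    finally show ?case by (simp add: euclidean_representation of_real_def)
  qed
qed

section \<open>Necessity: the set bound extracted from boundedness\<close>

text \<open>The test function \<open>f = h k / u\<close> satisfies both \<open>u * f = h k\<close>
  and |f|^p = \<open>h k\<close>, where \<open>h k\<close> is |u|^p' truncated on \<open>A\<close>.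
  With J the integral of \<open>h k\<close>, boundedness gives ||E(h k)||_q \<le> C J^(1/p), and
  Hoelder on \<open>A\<close> gives J \<le> \<mu>(A)^(1/q') ||E(h k)||_q. Dividing by J^(1/p) and
  raising to the power p' yields the bound with \<open>K = C powr p'\<close>.\<close>

lemma R_bounded_imp_superlinear_bound:
  fixes u :: "'a \<Rightarrow> 'k::{real_normed_field, euclidean_space}"
  assumes bdd: "R_bounded M F p q u" and u[measurable]: "u \<in> borel_measurable M"
    and p: "1 < p" "1 / p + 1 / p' = 1" and q: "1 < q" "1 / q + 1 / q' = 1"
  obtains K where "0 \<le> K" "\<And>A. A \<in> sets F \<Longrightarrow> emeasure M A < \<infinity> \<Longrightarrow>
      (\<integral>\<^sup>+x\<in>A. ennreal (norm (u x) powr p') \<partial>M) \<le> ennreal (K * measure M A powr (p' / q'))"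
proof -
  have p': "1 < p'" and q': "1 < q'" using conjugate_exponent_gt_1 p q by blast+
  have pp': "(p' - 1) * p = p'" using p p' by (simp add: field_simps)
  obtain C0 where C0: "\<And>f. f \<in> Lp_space M p \<Longrightarrow> Lp_norm M q (R_op M F u f) \<le> C0 * Lp_norm M p f"
    using bdd by (auto simp: R_bounded_def bounded_Lp_Lq_def)
  \<comment> \<open>The constant in the definition of boundedness may be negative; its absolute
    value is still a bound and behaves well under \<open>powr\<close>.\<close>
  define C where "C = \<bar>C0\<bar>"
  have C: "Lp_norm M q (R_op M F u f) \<le> C * Lp_norm M p f" if "f \<in> Lp_space M p" for f :: "'a \<Rightarrow> 'k"
    by (rule order_trans[OF C0[OF that]], rule mult_right_mono) (auto simp: C_def Lp_norm_def)
  have C_nn: "0 \<le> C" by (simp add: C_def)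
  show thesis
  proof (rule that[of "C powr p'"])
    fix A assume AF[measurable]: "A \<in> sets F" and fin: "emeasure M A < \<infinity>"
    \<comment> \<open>Restricting to \<open>A\<close>, of finite measure, and cutting off where |u|
      exceeds \<open>k\<close> makes the test function integrable; nothing is known yet about the
      integral of |u|^p' over \<open>A\<close>.\<close>
    have A[measurable]: "A \<in> sets M" using AF subalg by (auto simp: subalgebra_def)
    define h where "h k x = (if x \<in> A \<and> norm (u x) \<le> real k then norm (u x) powr p' else 0)" for k :: nat and x
    have h[measurable]: "h k \<in> borel_measurable M" for k unfolding h_def by measurable
    have h_nn: "0 \<le> h k x" for k x by (simp add: h_def)
    have bnd: "(\<integral>\<^sup>+x. ennreal (h k x) \<partial>M) \<le> ennreal (C powr p' * measure M A powr (p' / q'))" for k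
    proof -
      have ind: "integrable M (\<lambda>x. real k powr p' * indicator A x)"
        using A fin by (intro integrable_mult_right integrable_real_indicator)
      have int_h: "integrable M (h k)"
        by (rule Bochner_Integration.integrable_bound[OF ind])
          (use p' in \<open>auto simp: h_def indicator_def intro!: powr_mono2\<close>)
      \<comment> \<open>Where \<open>u x = 0\<close>, division by zero makes \<open>f x = 0\<close>,
        and \<open>h k x\<close> is 0 there too, so \<open>u x * f x = h k x\<close> holds
        everywhere.\<close>
      define f where "f x = of_real (h k x) / u x" for x
      have f[measurable]: "f \<in> borel_measurable M" unfolding f_def by measurable
      have uf: "u x * f x = of_real (h k x)" for x by (simp add: f_def h_def)
      have nf: "norm (f x) powr p = h k x" for x
      proof (cases "x \<in> A \<and> norm (u x) \<le> real k \<and> u x \<noteq> 0")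
        case True
        then have "norm (f x) = norm (u x) powr (p' - 1)"
          by (simp add: f_def h_def norm_divide powr_diff)
        then show ?thesis using True by (simp add: powr_powr pp' h_def)
      qed (auto simp: f_def h_def)
      have fL: "f \<in> Lp_space M p" unfolding Lp_space_def using int_h by (simp add: nf)
      define e where "e = real_cond_exp M F (h k)"
      have e[measurable]: "e \<in> borel_measurable M" by (simp add: e_def)
      define J where "J = (\<integral>x. h k x \<partial>M)"
      have J: "0 \<le> J" unfolding J_def using h_nn by simp
      have Re: "AE x in M. R_op M F u f x = of_real (e x)"
        unfolding R_op_def uf e_def by (rule cond_exp_of_real[OF int_h])
      have RL: "R_op M F u f \<in> Lp_space M q"
        using bdd fL by (auto simp: R_bounded_def bounded_Lp_Lq_def)
      have [measurable]: "R_op M F u f \<in> borel_measurable M" using RL by (simp add: Lp_space_def)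
      have aeq: "AE x in M. norm (R_op M F u f x) powr q = \<bar>e x\<bar> powr q"
        using Re by eventually_elim simp
      have int_e: "integrable M (\<lambda>x. \<bar>e x\<bar> powr q)"
        using RL integrable_cong_AE[OF _ _ aeq] by (simp add: Lp_space_def)
      have "(\<integral>x. \<bar>e x\<bar> powr q \<partial>M) powr (1 / q) = Lp_norm M q (R_op M F u f)"
        unfolding Lp_norm_def using integral_cong_AE[OF _ _ aeq] by simp
      also have "\<dots> \<le> C * J powr (1 / p)" using C[OF fL] by (simp add: Lp_norm_def nf J_def)
      finally have eq_bound: "(\<integral>x. \<bar>e x\<bar> powr q \<partial>M) powr (1 / q) \<le> C * J powr (1 / p)" .
      have ind': "(indicator A x :: real) powr q' = indicator A x" for x by (simp add: indicator_def)
      have "J = (\<integral>x\<in>A. h k x \<partial>M)"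
        unfolding J_def set_lebesgue_integral_def
        by (intro Bochner_Integration.integral_cong) (auto simp: h_def indicator_def)
      also have "\<dots> = (\<integral>x\<in>A. e x \<partial>M)" unfolding e_def using int_h by (intro real_cond_exp_intA) auto
      finally have Je: "J = (\<integral>x. indicator A x * e x \<partial>M)" by (simp add: set_lebesgue_integral_def)
      have "integrable M e" unfolding e_def using int_h by (rule real_cond_exp_int)
      then have ie: "integrable M (\<lambda>x. indicator A x * e x)"
        using integrable_mult_indicator[OF A, of e] by simp
      have "ennreal J \<le> (\<integral>\<^sup>+x. ennreal (norm (indicator A x * e x)) \<partial>M)"
        using integral_norm_bound_ennreal[OF ie] J by (simp add: Je[symmetric])
      also have "\<dots> = (\<integral>\<^sup>+x. ennreal (indicator A x * \<bar>e x\<bar>) \<partial>M)"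
        by (simp add: abs_mult)
      also have "\<dots> \<le> ennreal ((\<integral>x. indicator A x powr q' \<partial>M) powr (1 / q')
          * (\<integral>x. \<bar>e x\<bar> powr q \<partial>M) powr (1 / q))"
        using q q' int_e A fin by (intro Holder_nn_integral) (auto simp: ind')
      also have "\<dots> = ennreal (measure M A powr (1 / q') * (\<integral>x. \<bar>e x\<bar> powr q \<partial>M) powr (1 / q))"
        using A by (simp add: ind')
      finally have "J \<le> measure M A powr (1 / q') * (\<integral>x. \<bar>e x\<bar> powr q \<partial>M) powr (1 / q)"
        by (subst (asm) ennreal_le_iff) auto
      also have "\<dots> \<le> measure M A powr (1 / q') * (C * J powr (1 / p))"
        using eq_bound by (intro mult_left_mono) auto
      finally have JJ: "J \<le> (C * measure M A powr (1 / q')) * J powr (1 / p)" by (simp add: mult_ac)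
      \<comment> \<open>The truncation keeps \<open>J\<close> finite, so for nonzero
        \<open>J\<close> the common factor \<open>J powr (1 / p)\<close> may be cancelled, leaving
        the exponent \<open>1 - 1 / p = 1 / p'\<close>.\<close>
      have "J \<le> (C * measure M A powr (1 / q')) powr p'"
      proof (cases "J = 0")
        case False
        then have J0: "0 < J" using J by simp
        have "J = J powr (1 / p') * J powr (1 / p)"
          using J0 p by (simp add: powr_add[symmetric] add.commute)
        then have "J powr (1 / p') * J powr (1 / p) \<le> (C * measure M A powr (1 / q')) * J powr (1 / p)"
          using JJ by simp
        then have "J powr (1 / p') \<le> C * measure M A powr (1 / q')"
          using J0 by simp
        then have "(J powr (1 / p')) powr p' \<le> (C * measure M A powr (1 / q')) powr p'"
          using p' by (intro powr_mono2) auto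
        then show ?thesis using J0 p' by (simp add: powr_powr)
      qed simp
      also have "\<dots> = C powr p' * measure M A powr (p' / q')"
        using C_nn by (simp add: powr_mult powr_powr)
      finally have "ennreal J \<le> ennreal (C powr p' * measure M A powr (p' / q'))"
        by (rule ennreal_leI)
      then show ?thesis using int_h h_nn by (simp add: J_def nn_integral_eq_integral)
    qed
    \<comment> \<open>Monotone convergence removes the truncation, as the bound on the integral of
      \<open>h k\<close> does not depend on \<open>k\<close>.\<close>
    have "(\<integral>\<^sup>+x\<in>A. ennreal (norm (u x) powr p') \<partial>M) \<le> (\<integral>\<^sup>+x. (SUP k. ennreal (h k x)) \<partial>M)"
    proof (rule nn_integral_mono)
      fix x
      obtain k :: nat where "norm (u x) \<le> real k" using real_arch_simple by blast
      then have "ennreal (norm (u x) powr p') * indicator A x = ennreal (h k x)"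
        by (auto simp: h_def indicator_def)
      then show "ennreal (norm (u x) powr p') * indicator A x \<le> (SUP k. ennreal (h k x))"
        by (auto intro!: SUP_upper)
    qed
    also have "\<dots> = (SUP k. \<integral>\<^sup>+x. ennreal (h k x) \<partial>M)"
      by (intro nn_integral_monotone_convergence_SUP)
        (auto simp: incseq_def le_fun_def h_def intro!: ennreal_leI)
    also have "\<dots> \<le> ennreal (C powr p' * measure M A powr (p' / q'))"
      by (intro SUP_least bnd)
    finally show "(\<integral>\<^sup>+x\<in>A. ennreal (norm (u x) powr p') \<partial>M)
        \<le> ennreal (C powr p' * measure M A powr (p' / q'))" .
  qed simp
qed

section \<open>Sufficiency: estimates on atoms and their integration\<close>

lemma borel_measurable_cond_exp_vec [measurable]: "cond_exp M F f \<in> borel_measurable M"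
  unfolding cond_exp_def by measurable

text \<open>A non-negative function vanishes a.e. on \<open>B\<close> exactly when its integral over
  \<open>B\<close> is 0, and \<open>g\<close> and its conditional expectation have the same integral
  over \<open>B\<close>.\<close>

lemma nn_cond_exp_zero_on_iff:
  assumes B[measurable]: "B \<in> sets F" and g[measurable]: "g \<in> borel_measurable M"
  shows "(AE x in M. x \<in> B \<longrightarrow> nn_cond_exp M F g x = 0) \<longleftrightarrow> (AE x in M. x \<in> B \<longrightarrow> g x = 0)"
proof -
  have [measurable]: "B \<in> sets M" using B subalg by (auto simp: subalgebra_def)
  have *: "(\<integral>\<^sup>+x\<in>B. h x \<partial>M) = 0 \<longleftrightarrow> (AE x in M. x \<in> B \<longrightarrow> h x = 0)"
    if [measurable]: "h \<in> borel_measurable M" for h :: "'a \<Rightarrow> ennreal"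
  proof -
    have eq: "(x \<in> B \<longrightarrow> h x = 0) \<longleftrightarrow> h x * indicator B x = 0" for x by (auto simp: indicator_def)
    show ?thesis unfolding eq by (rule nn_integral_0_iff_AE) measurable
  qed
  show ?thesis
    using *[of "nn_cond_exp M F g"] *[OF g] by (simp add: set_nn_integral_nn_cond_exp)
qed

text \<open>Each coordinate is dominated by the norm, and the norm by the sum of the absolute
  coordinates. The crude dimension factor only enlarges the operator bound.\<close>

lemma norm_cond_exp_le:
  fixes f :: "'a \<Rightarrow> 'k::euclidean_space"
  assumes [measurable]: "f \<in> borel_measurable M"
  shows "AE x in M. ennreal (norm (cond_exp M F f x))
    \<le> of_nat DIM('k) * nn_cond_exp M F (\<lambda>x. ennreal (norm (f x))) x"
proof -
  have "AE x in M. \<forall>b\<in>Basis. ennreal \<bar>real_cond_exp M F (\<lambda>x. f x \<bullet> b) x\<bar>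
      \<le> nn_cond_exp M F (\<lambda>x. ennreal (norm (f x))) x"
  proof (intro AE_finite_allI finite_Basis)
    fix b :: 'k assume b: "b \<in> Basis"
    have "AE x in M. ennreal \<bar>real_cond_exp M F (\<lambda>x. f x \<bullet> b) x\<bar>
        \<le> nn_cond_exp M F (\<lambda>x. ennreal \<bar>f x \<bullet> b\<bar>) x"
      by (rule real_cond_exp_abs) simp
    moreover have "AE x in M. nn_cond_exp M F (\<lambda>x. ennreal \<bar>f x \<bullet> b\<bar>) x
        \<le> nn_cond_exp M F (\<lambda>x. ennreal (norm (f x))) x"
      by (intro nn_cond_exp_mono) (auto intro!: ennreal_leI Basis_le_norm b)
    ultimately show "AE x in M. ennreal \<bar>real_cond_exp M F (\<lambda>x. f x \<bullet> b) x\<bar>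
        \<le> nn_cond_exp M F (\<lambda>x. ennreal (norm (f x))) x"
      by eventually_elim (rule order_trans)
  qed
  then show ?thesis
  proof eventually_elim
    case (elim x)
    have "norm (cond_exp M F f x) \<le> (\<Sum>b\<in>Basis. \<bar>real_cond_exp M F (\<lambda>x. f x \<bullet> b) x\<bar>)"
      unfolding cond_exp_def by (rule sum_norm_le) simp
    then have "ennreal (norm (cond_exp M F f x)) \<le> (\<Sum>b\<in>Basis. ennreal \<bar>real_cond_exp M F (\<lambda>x. f x \<bullet> b) x\<bar>)"
      by (simp add: ennreal_leI)
    also have "\<dots> \<le> (\<Sum>b\<in>(Basis::'k set). nn_cond_exp M F (\<lambda>x. ennreal (norm (f x))) x)"
      using elim by (intro sum_mono) auto
    finally show ?case by simp
  qed
qed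

text \<open>On an atom of measure m, E(|uf|) and E(|f|^p) are averages. With P the integral of |f|^p
  over the atom, Hoelder and the set bound give E(|uf|) \<le> K^(1/p') m^(1/q' - 1) P^(1/p). Since
  1/q' - 1 = -1/q, the power q of this is a constant times P^(q/p) / m, to be compared with E(|f|^p)
  = P / m.\<close>

lemma R_op_on_atom:
  fixes u f :: "'a \<Rightarrow> 'k::{real_normed_field, euclidean_space}"
  assumes at: "is_atom (restr_to_subalg M F) A"
    and u[measurable]: "u \<in> borel_measurable M" and f: "f \<in> Lp_space M p"
    and p: "1 < p" "p < q" "1 / p + 1 / p' = 1" and q: "1 / q + 1 / q' = 1"
    and K: "0 \<le> K"
    and bound: "(\<integral>\<^sup>+x\<in>A. ennreal (norm (u x) powr p') \<partial>M) \<le> ennreal (K * measure M A powr (p' / q'))"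
  shows "AE x in M. x \<in> A \<longrightarrow> nn_cond_exp M F (\<lambda>y. ennreal (norm (u y * f y))) x < \<infinity>" (is ?fin)
    and "AE x in M. x \<in> A \<longrightarrow> ennreal (norm (R_op M F u f x) powr q)
      \<le> ennreal ((DIM('k) * K powr (1 / p')) powr q * (\<integral>x. norm (f x) powr p \<partial>M) powr (q / p - 1))
        * nn_cond_exp M F (\<lambda>y. ennreal (norm (f y) powr p)) x" (is ?le)
proof -
  have p': "1 < p'" and q': "1 < q'" using conjugate_exponent_gt_1[of p p'] conjugate_exponent_gt_1[of q q'] p q by auto
  note A = is_atom_subalgD[OF at]
  note A(2)[measurable]
  have [measurable]: "f \<in> borel_measurable M" using f by (simp add: Lp_space_def)
  define m where "m = measure M A"
  have em: "emeasure M A = ennreal m" using A by (simp add: m_def emeasure_eq_ennreal_measure)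
  have m: "0 < m" using A by (simp add: em)
  define T where "T = (\<integral>x. norm (f x) powr p \<partial>M)"
  define P where "P = (\<integral>x. (indicator A x * norm (f x)) powr p \<partial>M)"
  define \<nu> where "\<nu> = (\<integral>x. (indicator A x * norm (u x)) powr p' \<partial>M)"
  have int_f: "integrable M (\<lambda>x. norm (f x) powr p)" using f by (simp add: Lp_space_def)
  have ind: "(indicator A x * c) powr r = indicator A x * c powr r" for x and c r :: real
    by (simp add: indicator_def)
  have int_P: "integrable M (\<lambda>x. (indicator A x * norm (f x)) powr p)"
    unfolding ind using integrable_mult_indicator[OF A(2) int_f] by simp
  have P: "0 \<le> P" unfolding P_def by simp
  have PT: "P \<le> T" unfolding P_def T_def
    by (intro integral_mono int_P int_f) (auto simp: indicator_def)
  have nn_P: "(\<integral>\<^sup>+x\<in>A. ennreal (norm (f x) powr p) \<partial>M) = ennreal P"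
    unfolding P_def using int_P
    by (subst nn_integral_eq_integral[symmetric]) (auto intro!: nn_integral_cong simp: indicator_def)
  have eq_u: "(\<integral>\<^sup>+x\<in>A. ennreal (norm (u x) powr p') \<partial>M)
      = (\<integral>\<^sup>+x. ennreal ((indicator A x * norm (u x)) powr p') \<partial>M)"
    by (auto intro!: nn_integral_cong simp: indicator_def)
  have int_\<nu>: "integrable M (\<lambda>x. (indicator A x * norm (u x)) powr p')"
    using bound by (intro integrableI_nonneg) (auto simp: eq_u intro: le_less_trans)
  have \<nu>: "0 \<le> \<nu>" unfolding \<nu>_def by simp
  have "ennreal \<nu> \<le> ennreal (K * m powr (p' / q'))"
    using bound int_\<nu> unfolding eq_u by (simp add: \<nu>_def m_def nn_integral_eq_integral)
  then have \<nu>_le: "\<nu> \<le> K * m powr (p' / q')" using K by (subst (asm) ennreal_le_iff) auto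
  define W where "W = K powr (1 / p') * m powr (1 / q') * P powr (1 / p)"
  have "(\<integral>\<^sup>+x\<in>A. ennreal (norm (u x * f x)) \<partial>M)
      = (\<integral>\<^sup>+x. ennreal ((indicator A x * norm (u x)) * (indicator A x * norm (f x))) \<partial>M)"
    by (auto intro!: nn_integral_cong simp: indicator_def norm_mult)
  also have "\<dots> \<le> ennreal (\<nu> powr (1 / p') * P powr (1 / p))"
    unfolding \<nu>_def P_def using p p' int_\<nu> int_P by (intro Holder_nn_integral) auto
  also have "\<dots> \<le> ennreal (((K * m powr (p' / q')) powr (1 / p')) * P powr (1 / p))"
    using \<nu> \<nu>_le p' by (intro ennreal_leI mult_right_mono powr_mono2) auto
  also have "(K * m powr (p' / q')) powr (1 / p') = K powr (1 / p') * m powr (1 / q')"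
    using K m p' by (simp add: powr_mult powr_powr)
  finally have uf_le: "(\<integral>\<^sup>+x\<in>A. ennreal (norm (u x * f x)) \<partial>M) \<le> ennreal W" by (simp add: W_def)
  have W: "0 \<le> W" by (simp add: W_def)
  have "AE x in M. x \<in> A \<longrightarrow> nn_cond_exp M F (\<lambda>y. ennreal (norm (u y * f y))) x
      = (\<integral>\<^sup>+x\<in>A. ennreal (norm (u x * f x)) \<partial>M) / ennreal m"
    unfolding em[symmetric] by (rule nn_cond_exp_on_atom[OF at]) simp
  then have e_le: "AE x in M. x \<in> A \<longrightarrow> nn_cond_exp M F (\<lambda>y. ennreal (norm (u y * f y))) x \<le> ennreal (W / m)"
  proof eventually_elim
    case (elim x)
    then show ?case
      using divide_right_mono_ennreal[OF uf_le, of "ennreal m"] m W by (auto simp: divide_ennreal)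
  qed
  then show ?fin by eventually_elim (auto intro: le_less_trans)
  have f_eq: "AE x in M. x \<in> A \<longrightarrow> nn_cond_exp M F (\<lambda>y. ennreal (norm (f y) powr p)) x = ennreal (P / m)"
    using nn_cond_exp_on_atom[OF at, of "\<lambda>y. ennreal (norm (f y) powr p)"] m P
    by (simp add: nn_P em divide_ennreal)
  define d where "d = real DIM('k)"
  have d: "0 < d" by (simp add: d_def)
  have "AE x in M. ennreal (norm (R_op M F u f x))
      \<le> of_nat DIM('k) * nn_cond_exp M F (\<lambda>x. ennreal (norm (u x * f x))) x"
    unfolding R_op_def by (rule norm_cond_exp_le) simp
  with e_le f_eq show ?le
  proof eventually_elim
    case (elim x)
    show ?case
    proof
      assume x: "x \<in> A"
      have "ennreal (norm (R_op M F u f x)) \<le> of_nat DIM('k) * ennreal (W / m)"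
        using elim x by (meson mult_left_mono order_trans zero_le)
      also have "\<dots> = ennreal (d * (W / m))"
        by (simp add: d_def ennreal_mult'[symmetric] ennreal_of_nat_eq_real_of_nat)
      finally have R: "norm (R_op M F u f x) \<le> d * (W / m)"
        using d W m by (subst (asm) ennreal_le_iff) auto
      have "1 / q' - 1 = - (1 / q)" using q by simp
      then have m_powr: "m powr (- (1 / q)) = m powr (1 / q') / m"
        using m powr_diff[of m "1 / q'" 1] by simp
      have "d * (W / m) = d * K powr (1 / p') * (m powr (- (1 / q)) * P powr (1 / p))"
        by (simp only: m_powr) (simp add: W_def)
      then have "norm (R_op M F u f x) powr q
          \<le> (d * K powr (1 / p') * (m powr (- (1 / q)) * P powr (1 / p))) powr q"
        using R p by (intro powr_mono2) auto
      also have "\<dots> = (d * K powr (1 / p')) powr q * (P powr (q / p) / m)"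
        using d m p by (simp add: powr_mult powr_divide powr_powr powr_minus_divide)
      \<comment> \<open>Splitting off one factor \<open>P\<close> keeps the estimate linear in
        E(|f|^p), so it can be integrated. The surplus power has the positive exponent
        \<open>q / p - 1\<close> and is bounded through the global integral \<open>T\<close>, the
        same for all atoms.\<close>
      also have "P powr (q / p) = P powr (q / p - 1) * P"
        using P powr_add[of P "q / p - 1" 1] by (cases "P = 0") auto
      also have "(d * K powr (1 / p')) powr q * (P powr (q / p - 1) * P / m)
          \<le> (d * K powr (1 / p')) powr q * (T powr (q / p - 1) * P / m)"
        using P PT m p
        by (intro mult_left_mono divide_right_mono mult_right_mono powr_mono2) (auto simp: field_simps)
      finally have "norm (R_op M F u f x) powr q
          \<le> ((d * K powr (1 / p')) powr q * T powr (q / p - 1)) * (P / m)" by simp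
      then have "ennreal (norm (R_op M F u f x) powr q)
          \<le> ennreal ((d * K powr (1 / p')) powr q * T powr (q / p - 1)) * ennreal (P / m)"
        using P m by (subst ennreal_mult[symmetric]) (auto intro!: ennreal_leI)
      then show "ennreal (norm (R_op M F u f x) powr q)
        \<le> ennreal ((DIM('k) * K powr (1 / p')) powr q * (\<integral>x. norm (f x) powr p \<partial>M) powr (q / p - 1))
          * nn_cond_exp M F (\<lambda>y. ennreal (norm (f y) powr p)) x"
        using elim x by (simp add: d_def T_def)
    qed
  qed
qed

text \<open>The pointwise bound holds on every atom, and on \<open>B\<close> both E(|uf|) and
  \<open>R_op M F u f\<close> vanish; countability merges these into one a.e. statement.
  Integrating, with E(|f|^p) having integral \<open>T\<close>, turns
  \<open>T powr (q / p - 1)\<close> into \<open>T powr (q / p)\<close>, whose root of order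
  \<open>q\<close> is the norm of \<open>f\<close>.\<close>

lemma superlinear_bound_imp_R_bounded:
  fixes u :: "'a \<Rightarrow> 'k::{real_normed_field, euclidean_space}"
  assumes cover: "space M = (\<Union>n\<in>I. A n) \<union> B" and I: "countable I"
    and at: "\<And>n. n \<in> I \<Longrightarrow> is_atom (restr_to_subalg M F) (A n)" and B: "B \<in> sets F"
    and u[measurable]: "u \<in> borel_measurable M"
    and p: "1 < p" "p < q" "1 / p + 1 / p' = 1" and q: "1 / q + 1 / q' = 1"
    and zero: "AE x in M. x \<in> B \<longrightarrow> u x = 0"
    and K: "0 \<le> K"
    and bound: "\<And>n. n \<in> I \<Longrightarrow> (\<integral>\<^sup>+x\<in>A n. ennreal (norm (u x) powr p') \<partial>M)
      \<le> ennreal (K * measure M (A n) powr (p' / q'))"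
  shows "R_bounded M F p q u"
proof -
  define c where "c = real DIM('k) * K powr (1 / p')"
  have c: "0 \<le> c" by (simp add: c_def)
  have *: "conditionable M F (\<lambda>x. u x * f x) \<and> R_op M F u f \<in> Lp_space M q
      \<and> Lp_norm M q (R_op M F u f) \<le> c * Lp_norm M p f" if f: "f \<in> Lp_space M p" for f :: "'a \<Rightarrow> 'k"
  proof -
    have fm[measurable]: "f \<in> borel_measurable M" using f by (simp add: Lp_space_def)
    define e where "e = nn_cond_exp M F (\<lambda>y. ennreal (norm (u y * f y)))"
    define g where "g = nn_cond_exp M F (\<lambda>y. ennreal (norm (f y) powr p))"
    define T where "T = (\<integral>x. norm (f x) powr p \<partial>M)"
    have T: "0 \<le> T" by (simp add: T_def)
    have R_meas[measurable]: "R_op M F u f \<in> borel_measurable M" by (simp add: R_op_def)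
    have "AE x in M. x \<in> B \<longrightarrow> ennreal (norm (u x * f x)) = 0"
      using zero by eventually_elim auto
    then have eB: "AE x in M. x \<in> B \<longrightarrow> e x = 0"
      unfolding e_def using nn_cond_exp_zero_on_iff[OF B] by simp
    have eA: "AE x in M. \<forall>n\<in>I. x \<in> A n \<longrightarrow> e x < \<infinity>"
      unfolding e_def using I at bound R_op_on_atom(1)[OF _ u f p q K] by (subst AE_ball_countable) auto
    have RA: "AE x in M. \<forall>n\<in>I. x \<in> A n \<longrightarrow> ennreal (norm (R_op M F u f x) powr q)
        \<le> ennreal (c powr q * T powr (q / p - 1)) * g x"
      unfolding c_def T_def g_def
      using I at bound R_op_on_atom(2)[OF _ u f p q K] by (subst AE_ball_countable) auto
    have fin: "AE x in M. e x < \<infinity>"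
      using eB eA AE_space
    proof eventually_elim
      case (elim x)
      then show ?case using cover by (cases "x \<in> B") auto
    qed
    have "AE x in M. ennreal (norm (R_op M F u f x)) \<le> of_nat DIM('k) * e x"
      unfolding R_op_def e_def by (rule norm_cond_exp_le) simp
    then have R_le: "AE x in M. ennreal (norm (R_op M F u f x) powr q)
        \<le> ennreal (c powr q * T powr (q / p - 1)) * g x"
      using eB RA AE_space
    proof eventually_elim
      case (elim x)
      then show ?case using cover by (cases "x \<in> B") auto
    qed
    have int_f: "integrable M (\<lambda>x. norm (f x) powr p)" using f by (simp add: Lp_space_def)
    have "(\<integral>\<^sup>+x. g x \<partial>M) = (\<integral>\<^sup>+x. ennreal (norm (f x) powr p) \<partial>M)"
      using nn_cond_exp_intg[of "\<lambda>_. 1" "\<lambda>x. ennreal (norm (f x) powr p)"] by (simp add: g_def)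
    also have "\<dots> = ennreal T" using int_f by (simp add: T_def nn_integral_eq_integral)
    finally have gT: "(\<integral>\<^sup>+x. g x \<partial>M) = ennreal T" .
    have [measurable]: "g \<in> borel_measurable M" by (simp add: g_def)
    have "(\<integral>\<^sup>+x. ennreal (norm (R_op M F u f x) powr q) \<partial>M)
        \<le> (\<integral>\<^sup>+x. ennreal (c powr q * T powr (q / p - 1)) * g x \<partial>M)"
      by (rule nn_integral_mono_AE[OF R_le])
    also have "\<dots> = ennreal (c powr q * T powr (q / p - 1)) * ennreal T"
      by (simp add: nn_integral_cmult gT)
    also have "\<dots> = ennreal (c powr q * (T powr (q / p - 1) * T))"
      using T by (simp add: ennreal_mult[symmetric] mult.assoc)
    also have "T powr (q / p - 1) * T = T powr (q / p)"
      using T powr_add[of T "q / p - 1" 1] by (cases "T = 0") auto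
    finally have nn: "(\<integral>\<^sup>+x. ennreal (norm (R_op M F u f x) powr q) \<partial>M) \<le> ennreal (c powr q * T powr (q / p))" .
    have int_R: "integrable M (\<lambda>x. norm (R_op M F u f x) powr q)"
      using nn by (intro integrableI_nonneg) (auto intro: le_less_trans)
    have "ennreal (\<integral>x. norm (R_op M F u f x) powr q \<partial>M) \<le> ennreal (c powr q * T powr (q / p))"
      using nn int_R by (simp add: nn_integral_eq_integral)
    then have "(\<integral>x. norm (R_op M F u f x) powr q \<partial>M) \<le> c powr q * T powr (q / p)"
      by (subst (asm) ennreal_le_iff) auto
    then have "Lp_norm M q (R_op M F u f) \<le> (c powr q * T powr (q / p)) powr (1 / q)"
      unfolding Lp_norm_def using p by (intro powr_mono2) auto
    also have "\<dots> = c * Lp_norm M p f"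
      using c p T by (simp add: powr_mult powr_powr Lp_norm_def T_def)
    finally show ?thesis
      using fin int_R by (simp add: conditionable_def e_def Lp_space_def)
  qed
  then show ?thesis
    by (auto simp: R_bounded_def R_well_defined_def bounded_Lp_Lq_def)
qed

section \<open>Necessity on the non-atomic part\<close>

text \<open>Atoms are excluded only with respect to \<open>F\<close>, so the superlinear bound is
  applied in the restricted measure space. The weight must then be \<open>F\<close>-measurable:
  E(|u|^p') replaces |u|^p', having the same integrals over sets of \<open>F\<close>. Its vanishing
  on \<open>B\<close> passes back to \<open>u\<close>.\<close>

lemma R_bounded_imp_zero_on_nonatomic:
  fixes u :: "'a \<Rightarrow> 'k::{real_normed_field, euclidean_space}"
  assumes bdd: "R_bounded M F p q u" and u[measurable]: "u \<in> borel_measurable M"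
    and p: "1 < p" "p < q" "1 / p + 1 / p' = 1" and q: "1 / q + 1 / q' = 1"
    and B: "B \<in> sets F" and nonat: "nonatomic (restrict_space (restr_to_subalg M F) B)"
  shows "AE x in M. x \<in> B \<longrightarrow> u x = 0"
proof -
  interpret r: sigma_finite_measure "restr_to_subalg M F" by (rule sigma_fin_subalg)
  define w where "w = nn_cond_exp M F (\<lambda>y. ennreal (norm (u y) powr p'))"
  have B': "B \<in> sets (restr_to_subalg M F)" using B by (simp add: sets_restr_to_subalg[OF subalg])
  have "1 < q" using p by simp
  then obtain K where K: "0 \<le> K" "\<And>A. A \<in> sets F \<Longrightarrow> emeasure M A < \<infinity> \<Longrightarrow>
      (\<integral>\<^sup>+x\<in>A. ennreal (norm (u x) powr p') \<partial>M) \<le> ennreal (K * measure M A powr (p' / q'))"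
    by (rule R_bounded_imp_superlinear_bound[OF bdd u p(1,3) _ q]) blast
  have "AE x in restr_to_subalg M F. x \<in> B \<longrightarrow> w x = 0"
  proof (rule r.superlinear_bound_imp_zero[OF _ B' _ _ K(1)])
    show "w \<in> borel_measurable (restr_to_subalg M F)"
      unfolding w_def by (rule measurable_in_subalg[OF subalg]) simp
    show "\<not> is_atom (restr_to_subalg M F) S" if "S \<subseteq> B" for S
      using nonat that is_atom_restrict_space[OF B'] by (auto simp: nonatomic_def)
    show "1 < p' / q'" using conjugate_ratio_gt_1 p q by blast
    fix A assume A: "A \<in> sets (restr_to_subalg M F)" "emeasure (restr_to_subalg M F) A < \<infinity>"
    then have AF[measurable]: "A \<in> sets F" by (simp add: sets_restr_to_subalg[OF subalg])
    note em = emeasure_restr_to_subalg[OF subalg AF]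
    have "(\<integral>\<^sup>+x\<in>A. w x \<partial>restr_to_subalg M F) = (\<integral>\<^sup>+x\<in>A. w x \<partial>M)"
      by (intro nn_integral_subalgebra2[OF subalg]) (simp add: w_def)
    also have "\<dots> = (\<integral>\<^sup>+x\<in>A. ennreal (norm (u x) powr p') \<partial>M)"
      unfolding w_def by (intro set_nn_integral_nn_cond_exp) auto
    also have "\<dots> \<le> ennreal (K * measure M A powr (p' / q'))"
      using K(2)[OF AF] A em by simp
    finally show "(\<integral>\<^sup>+x\<in>A. w x \<partial>restr_to_subalg M F)
        \<le> ennreal (K * measure (restr_to_subalg M F) A powr (p' / q'))"
      by (simp add: measure_def em)
  qed
  then have "AE x in M. x \<in> B \<longrightarrow> w x = 0" by (rule AE_restr_to_subalg[OF subalg])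
  then have "AE x in M. x \<in> B \<longrightarrow> ennreal (norm (u x) powr p') = 0"
    unfolding w_def using nn_cond_exp_zero_on_iff[OF B] by simp
  then show ?thesis by eventually_elim auto
qed

section \<open>The criterion in terms of values on atoms\<close>

lemma atom_value_nn_cond_exp:
  assumes "is_atom (restr_to_subalg M F) A" "g \<in> borel_measurable M"
  shows "atom_value M A (nn_cond_exp M F g) = (\<integral>\<^sup>+x\<in>A. g x \<partial>M) / emeasure M A"
  by (rule atom_value_eqI[OF is_atom_subalgD(2,3) nn_cond_exp_on_atom]) (use assms in auto)

text \<open>The value on an atom of measure m is the integral of \<open>g\<close> divided by m, so
  each quotient is that integral divided by m^s; a finite supremum is a uniform constant
  \<open>K\<close>.\<close>

lemma SUP_atom_value_nn_cond_exp_finite_iff: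
  assumes at: "\<And>n. n \<in> I \<Longrightarrow> is_atom (restr_to_subalg M F) (A n)"
    and g[measurable]: "g \<in> borel_measurable M"
  shows "(SUP n\<in>I. atom_value M (A n) (nn_cond_exp M F g) / ennreal (measure M (A n) powr (s - 1))) < \<infinity>
    \<longleftrightarrow> (\<exists>K\<ge>0. \<forall>n\<in>I. (\<integral>\<^sup>+x\<in>A n. g x \<partial>M) \<le> ennreal (K * measure M (A n) powr s))"
    (is "Sup (?v ` I) < \<infinity> \<longleftrightarrow> _")
proof -
  have *: "?v n \<le> ennreal K \<longleftrightarrow> (\<integral>\<^sup>+x\<in>A n. g x \<partial>M) \<le> ennreal (K * measure M (A n) powr s)"
    if n: "n \<in> I" and K: "0 \<le> K" for n K
  proof -
    define m where "m = measure M (A n)"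
    have em: "emeasure M (A n) = ennreal m"
      using is_atom_subalgD(4)[OF at[OF n]] by (simp add: m_def emeasure_eq_ennreal_measure)
    have m: "0 < m" using is_atom_subalgD(3)[OF at[OF n]] by (simp add: em)
    have v: "?v n = (\<integral>\<^sup>+x\<in>A n. g x \<partial>M) / ennreal m / ennreal (m powr (s - 1))"
      using atom_value_nn_cond_exp[OF at[OF n] g] by (simp add: em m_def[symmetric])
    show ?thesis
    proof (cases "\<integral>\<^sup>+x\<in>A n. g x \<partial>M")
      case (real r)
      have "m * m powr (s - 1) = m powr s" using m powr_add[of m 1 "s - 1"] by simp
      then have "r / m / m powr (s - 1) = r / m powr s" by simp
      then have "?v n = ennreal (r / m powr s)"
        using real m v by (simp add: divide_ennreal)
      then show ?thesis using real m K by (simp add: m_def[symmetric] divide_le_eq)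
    next
      \<comment> \<open>An infinite integral stays infinite after division by finite numbers, so
        both sides of the equivalence fail.\<close>
      case top
      then have "?v n = top" using v by (simp add: ennreal_top_divide)
      then show ?thesis using top by (simp add: top_unique)
    qed
  qed
  show ?thesis
  proof
    assume "Sup (?v ` I) < \<infinity>"
    then obtain K where K: "0 \<le> K" "Sup (?v ` I) = ennreal K" by (cases "Sup (?v ` I)") auto
    then have "?v n \<le> ennreal K" if "n \<in> I" for n
      using SUP_upper[OF that, of ?v] K(2) by simp
    then show "\<exists>K\<ge>0. \<forall>n\<in>I. (\<integral>\<^sup>+x\<in>A n. g x \<partial>M) \<le> ennreal (K * measure M (A n) powr s)"
      using * K by blast
  next
    assume "\<exists>K\<ge>0. \<forall>n\<in>I. (\<integral>\<^sup>+x\<in>A n. g x \<partial>M) \<le> ennreal (K * measure M (A n) powr s)"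
    then obtain K where "0 \<le> K" "\<forall>n\<in>I. (\<integral>\<^sup>+x\<in>A n. g x \<partial>M) \<le> ennreal (K * measure M (A n) powr s)"
      by blast
    then have "Sup (?v ` I) \<le> ennreal K" using * by (intro SUP_least) blast
    then show "Sup (?v ` I) < \<infinity>" by (auto intro: le_less_trans)
  qed
qed

text \<open>The set bound over atoms serves as the common form to which both supremum conditions of
  the theorem are reduced.\<close>

lemma R_bounded_iff:
  fixes u :: "'a \<Rightarrow> 'k::{real_normed_field, euclidean_space}"
  assumes cover: "space M = (\<Union>n\<in>I. A n) \<union> B" and I: "countable I"
    and at: "\<And>n. n \<in> I \<Longrightarrow> is_atom (restr_to_subalg M F) (A n)" and B: "B \<in> sets F"
    and nonat: "nonatomic (restrict_space (restr_to_subalg M F) B)"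
    and u[measurable]: "u \<in> borel_measurable M"
    and p: "1 < p" "p < q" "1 / p + 1 / p' = 1" and q: "1 / q + 1 / q' = 1"
  shows "R_bounded M F p q u \<longleftrightarrow> (AE x in M. x \<in> B \<longrightarrow> u x = 0) \<and>
    (\<exists>K\<ge>0. \<forall>n\<in>I. (\<integral>\<^sup>+x\<in>A n. ennreal (norm (u x) powr p') \<partial>M)
      \<le> ennreal (K * measure M (A n) powr (p' / q')))"
proof
  assume bdd: "R_bounded M F p q u"
  have "1 < q" using p by simp
  then obtain K where K: "0 \<le> K" "\<And>A. A \<in> sets F \<Longrightarrow> emeasure M A < \<infinity> \<Longrightarrow>
      (\<integral>\<^sup>+x\<in>A. ennreal (norm (u x) powr p') \<partial>M) \<le> ennreal (K * measure M A powr (p' / q'))"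
    by (rule R_bounded_imp_superlinear_bound[OF bdd u p(1,3) _ q]) blast
  then show "(AE x in M. x \<in> B \<longrightarrow> u x = 0) \<and>
    (\<exists>K\<ge>0. \<forall>n\<in>I. (\<integral>\<^sup>+x\<in>A n. ennreal (norm (u x) powr p') \<partial>M)
      \<le> ennreal (K * measure M (A n) powr (p' / q')))"
    using R_bounded_imp_zero_on_nonatomic[OF bdd u p q B nonat] is_atom_subalgD[OF at] by blast
next
  assume "(AE x in M. x \<in> B \<longrightarrow> u x = 0) \<and>
    (\<exists>K\<ge>0. \<forall>n\<in>I. (\<integral>\<^sup>+x\<in>A n. ennreal (norm (u x) powr p') \<partial>M)
      \<le> ennreal (K * measure M (A n) powr (p' / q')))"
  then show "R_bounded M F p q u"
    using superlinear_bound_imp_R_bounded[OF cover I at B u p q] by blast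
qed

lemma R_op_eq_0:
  fixes v f :: "'a \<Rightarrow> 'k::{real_normed_field, euclidean_space}"
  assumes v[measurable]: "v \<in> borel_measurable M" and f[measurable]: "f \<in> borel_measurable M"
    and zero: "AE x in M. v x = 0"
  shows "AE x in M. R_op M F v f x = 0"
proof -
  have "space M \<in> sets F" using subalg by (metis sets.top subalgebra_def)
  moreover have "AE x in M. x \<in> space M \<longrightarrow> ennreal (norm (v x * f x)) = 0"
    using zero by eventually_elim auto
  ultimately have "AE x in M. x \<in> space M \<longrightarrow> nn_cond_exp M F (\<lambda>x. ennreal (norm (v x * f x))) x = 0"
    using nn_cond_exp_zero_on_iff[of "space M" "\<lambda>x. ennreal (norm (v x * f x))"] by simp
  moreover have "AE x in M. ennreal (norm (R_op M F v f x))
      \<le> of_nat DIM('k) * nn_cond_exp M F (\<lambda>x. ennreal (norm (v x * f x))) x"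
    unfolding R_op_def by (rule norm_cond_exp_le) simp
  ultimately show ?thesis using AE_space by eventually_elim auto
qed

section \<open>The full sigma-algebra: multiplication operators\<close>

lemma cond_exp_eq_self:
  fixes f :: "'a \<Rightarrow> 'k::euclidean_space"
  assumes eq: "sets F = sets M" and f[measurable]: "f \<in> borel_measurable M"
  shows "AE x in M. cond_exp M F f x = f x"
proof -
  have "AE x in M. \<forall>b\<in>Basis. real_cond_exp M F (\<lambda>x. f x \<bullet> b) x = f x \<bullet> b"
  proof (intro AE_finite_allI finite_Basis)
    fix b :: 'k
    have m: "g \<in> borel_measurable M \<Longrightarrow> g \<in> borel_measurable F" for g :: "'a \<Rightarrow> ennreal"
      by (subst measurable_cong_sets[OF eq refl])
    \<comment> \<open>As \<open>ennreal\<close> sends negative reals to 0, these are the positive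
      and negative parts of the coordinate, whose difference defines
      \<open>real_cond_exp\<close>.\<close>
    have "AE x in M. ennreal (f x \<bullet> b) = nn_cond_exp M F (\<lambda>x. ennreal (f x \<bullet> b)) x"
      "AE x in M. ennreal (- (f x \<bullet> b)) = nn_cond_exp M F (\<lambda>x. ennreal (- (f x \<bullet> b))) x"
      by (intro nn_cond_exp_F_meas m; measurable)+
    then show "AE x in M. real_cond_exp M F (\<lambda>x. f x \<bullet> b) x = f x \<bullet> b"
    proof eventually_elim
      case (elim x)
      then have "real_cond_exp M F (\<lambda>x. f x \<bullet> b) x = enn2real (ennreal (f x \<bullet> b)) - enn2real (ennreal (- (f x \<bullet> b)))"
        by (simp add: real_cond_exp_def)
      then show ?case by (cases "0 \<le> f x \<bullet> b") (simp_all add: ennreal_neg)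
    qed
  qed
  then show ?thesis
    by eventually_elim (simp add: cond_exp_def euclidean_representation)
qed

text \<open>Here E(|uf|) = |uf| a.e. is finite, so every product is conditionable;
  \<open>R_op M F u f\<close> agrees a.e. with \<open>u * f\<close>, and a.e. equality preserves
  membership and norm.\<close>

lemma R_bounded_iff_mult_bounded:
  fixes u :: "'a \<Rightarrow> 'k::{real_normed_field, euclidean_space}"
  assumes eq: "sets F = sets M" and u[measurable]: "u \<in> borel_measurable M"
  shows "R_bounded M F p q u \<longleftrightarrow> bounded_Lp_Lq M p q (\<lambda>f x. u x * f x)"
proof -
  have *: "conditionable M F (\<lambda>x. u x * f x) \<and> (R_op M F u f \<in> Lp_space M q \<longleftrightarrow> (\<lambda>x. u x * f x) \<in> Lp_space M q)
      \<and> Lp_norm M q (R_op M F u f) = Lp_norm M q (\<lambda>x. u x * f x)" if "f \<in> Lp_space M p" for f :: "'a \<Rightarrow> 'k"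
  proof -
    have [measurable]: "f \<in> borel_measurable M" using that by (simp add: Lp_space_def)
    have [measurable]: "R_op M F u f \<in> borel_measurable M" by (simp add: R_op_def)
    have "(\<lambda>x. ennreal (norm (u x * f x))) \<in> borel_measurable F"
      by (subst measurable_cong_sets[OF eq refl]) simp
    then have "AE x in M. ennreal (norm (u x * f x)) = nn_cond_exp M F (\<lambda>x. ennreal (norm (u x * f x))) x"
      by (rule nn_cond_exp_F_meas)
    then have "AE x in M. nn_cond_exp M F (\<lambda>x. ennreal (norm (u x * f x))) x < \<infinity>"
      by eventually_elim (metis ennreal_less_top infinity_ennreal_def)
    moreover have "AE x in M. R_op M F u f x = u x * f x"
      unfolding R_op_def by (rule cond_exp_eq_self[OF eq]) simp
    then have ae: "AE x in M. norm (R_op M F u f x) powr q = norm (u x * f x) powr q"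
      by eventually_elim simp
    ultimately show ?thesis
      using integrable_cong_AE[OF _ _ ae] integral_cong_AE[OF _ _ ae]
      by (simp add: conditionable_def Lp_space_def Lp_norm_def)
  qed
  then show ?thesis
    unfolding R_bounded_def R_well_defined_def bounded_Lp_Lq_def by auto
qed

text \<open>Now \<open>u\<close> itself equals a constant a a.e. on each atom, of measure m, and the
  integral of |u|^p' there is |a|^p' m. The set bound is thus the p'-th power of the bound on |a|,
  the constants being related by \<open>K = c powr p'\<close>.\<close>

lemma SUP_norm_atom_value_finite_iff:
  fixes u :: "'a \<Rightarrow> 'k::{real_normed_field, euclidean_space}"
  assumes eq: "sets F = sets M" and u[measurable]: "u \<in> borel_measurable M"
    and at: "\<And>n. n \<in> I \<Longrightarrow> is_atom (restr_to_subalg M F) (A n)"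
    and p': "0 < p'"
  shows "(SUP n\<in>I. ennreal (norm (atom_value M (A n) u) / measure M (A n) powr (1 / q' - 1 / p'))) < \<infinity>
    \<longleftrightarrow> (\<exists>K\<ge>0. \<forall>n\<in>I. (\<integral>\<^sup>+x\<in>A n. ennreal (norm (u x) powr p') \<partial>M)
      \<le> ennreal (K * measure M (A n) powr (p' / q')))"
    (is "Sup ((\<lambda>n. ennreal (?v n)) ` I) < \<infinity> \<longleftrightarrow> _")
proof -
  interpret r: sigma_finite_measure "restr_to_subalg M F" by (rule sigma_fin_subalg)
  have *: "?v n \<le> c \<longleftrightarrow> (\<integral>\<^sup>+x\<in>A n. ennreal (norm (u x) powr p') \<partial>M)
      \<le> ennreal (c powr p' * measure M (A n) powr (p' / q'))" if n: "n \<in> I" and c: "0 \<le> c" for n c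
  proof -
    note A = is_atom_subalgD[OF at[OF n]]
    note A(2)[measurable]
    define m where "m = measure M (A n)"
    have em: "emeasure M (A n) = ennreal m" using A by (simp add: m_def emeasure_eq_ennreal_measure)
    have m: "0 < m" using A by (simp add: em)
    have "u \<in> borel_measurable (restr_to_subalg M F)"
      by (rule measurable_in_subalg[OF subalg]) (subst measurable_cong_sets[OF eq refl], rule u)
    then obtain a where "AE x in restr_to_subalg M F. x \<in> A n \<longrightarrow> u x = a"
      using measurable_AE_const_on_atom[OF at[OF n] r.is_atom_finite[OF at[OF n]]] by blast
    then have a: "AE x in M. x \<in> A n \<longrightarrow> u x = a" by (rule AE_restr_to_subalg[OF subalg])
    then have v: "?v n = norm a / m powr (1 / q' - 1 / p')"
      using atom_value_eqI[OF A(2,3) a] by (simp add: m_def)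
    have "(\<integral>\<^sup>+x\<in>A n. ennreal (norm (u x) powr p') \<partial>M)
        = (\<integral>\<^sup>+x. ennreal (norm a powr p') * indicator (A n) x \<partial>M)"
      using a by (intro nn_integral_cong_AE) (auto elim!: eventually_mono simp: indicator_def)
    also have "\<dots> = ennreal (norm a powr p' * m)"
      using m by (simp add: nn_integral_cmult_indicator em ennreal_mult)
    finally have int: "(\<integral>\<^sup>+x\<in>A n. ennreal (norm (u x) powr p') \<partial>M) = ennreal (norm a powr p' * m)" .
    \<comment> \<open>The p'-th power of the denominator, times the factor m from integrating over
      the atom, gives exactly the power in the set bound.\<close>
    have "(1 / q' - 1 / p') * p' + 1 = p' / q'" using p' by (simp add: left_diff_distrib)
    then have mm: "m powr (p' / q') = (m powr (1 / q' - 1 / p')) powr p' * m"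
      using m powr_add[of m "(1 / q' - 1 / p') * p'" 1] unfolding powr_powr by simp
    have "?v n \<le> c \<longleftrightarrow> norm a \<le> c * m powr (1 / q' - 1 / p')"
      using m by (simp add: v divide_le_eq)
    also have "\<dots> \<longleftrightarrow> norm a powr p' \<le> (c * m powr (1 / q' - 1 / p')) powr p'"
    proof
      assume "norm a \<le> c * m powr (1 / q' - 1 / p')"
      then show "norm a powr p' \<le> (c * m powr (1 / q' - 1 / p')) powr p'"
        using p' by (intro powr_mono2) auto
    next
      assume le: "norm a powr p' \<le> (c * m powr (1 / q' - 1 / p')) powr p'"
      have "0 \<le> c * m powr (1 / q' - 1 / p')" using c by simp
      then show "norm a \<le> c * m powr (1 / q' - 1 / p')"
        using powr_less_mono2[OF p', of _ "norm a"] le by (meson not_le)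
    qed
    also have "\<dots> \<longleftrightarrow> norm a powr p' * m \<le> c powr p' * m powr (p' / q')"
      using m c by (simp add: mm powr_mult mult.assoc[symmetric])
    finally show ?thesis unfolding int m_def[symmetric] using m by (subst ennreal_le_iff) auto
  qed
  show ?thesis
  proof
    assume "Sup ((\<lambda>n. ennreal (?v n)) ` I) < \<infinity>"
    then obtain c where c: "0 \<le> c" "Sup ((\<lambda>n. ennreal (?v n)) ` I) = ennreal c"
      by (cases "Sup ((\<lambda>n. ennreal (?v n)) ` I)") auto
    then have "ennreal (?v n) \<le> ennreal c" if "n \<in> I" for n
      using SUP_upper[OF that, of "\<lambda>n. ennreal (?v n)"] c(2) by simp
    then have "?v n \<le> c" if "n \<in> I" for n using that c by (metis ennreal_le_iff)
    then show "\<exists>K\<ge>0. \<forall>n\<in>I. (\<integral>\<^sup>+x\<in>A n. ennreal (norm (u x) powr p') \<partial>M)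
      \<le> ennreal (K * measure M (A n) powr (p' / q'))"
      using * c by (intro exI[of _ "c powr p'"]) auto
  next
    assume "\<exists>K\<ge>0. \<forall>n\<in>I. (\<integral>\<^sup>+x\<in>A n. ennreal (norm (u x) powr p') \<partial>M)
      \<le> ennreal (K * measure M (A n) powr (p' / q'))"
    then obtain K where K: "0 \<le> K" "\<forall>n\<in>I. (\<integral>\<^sup>+x\<in>A n. ennreal (norm (u x) powr p') \<partial>M)
      \<le> ennreal (K * measure M (A n) powr (p' / q'))" by blast
    have "(K powr (1 / p')) powr p' = K" using K p' by (simp add: powr_powr)
    then have "?v n \<le> K powr (1 / p')" if "n \<in> I" for n
      using *[OF that, of "K powr (1 / p')"] K that by simp
    then have "Sup ((\<lambda>n. ennreal (?v n)) ` I) \<le> ennreal (K powr (1 / p'))"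
      by (intro SUP_least ennreal_leI)
    then show "Sup ((\<lambda>n. ennreal (?v n)) ` I) < \<infinity>" by (auto intro: le_less_trans)
  qed
qed

end

section \<open>Assembly of the three claims\<close>

theorem mainTheorem3:
  fixes M F :: "'a measure"
    and u :: "'a \<Rightarrow> 'k::{real_normed_field, euclidean_space}"
    and D :: "('a \<Rightarrow> 'k) set"
    and A :: "nat \<Rightarrow> 'a set" and I :: "nat set" and B :: "'a set"
    and p q p' q' :: real
  assumes "sigma_finite_measure M"
    and "subalgebra M F"
    and "sigma_finite_measure (restr_to_subalg M F)"
    and "space M = (\<Union>n\<in>I. A n) \<union> B"
    and "\<And>n. n \<in> I \<Longrightarrow> is_atom (restr_to_subalg M F) (A n)"
    and "disjoint_family_on A I"
    and "B \<in> sets F"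
    and "\<And>n. n \<in> I \<Longrightarrow> A n \<inter> B = {}"
    and "nonatomic (restrict_space (restr_to_subalg M F) B)"
    and "1 < p" and "p < q"
    and "1 / p + 1 / p' = 1" and "1 / q + 1 / q' = 1"
    and "u \<in> borel_measurable M"
    and "fun_subspace D" and "D \<subseteq> Lp_space M p" and "R_well_defined M F q u D"
  shows "(R_bounded M F p q u \<longleftrightarrow>
            (AE x in M. x \<in> B \<longrightarrow> nn_cond_exp M F (\<lambda>y. ennreal (norm (u y) powr p')) x = 0)
          \<and> (SUP n\<in>I. atom_value M (A n) (nn_cond_exp M F (\<lambda>y. ennreal (norm (u y) powr p')))
                        / ennreal (measure M (A n) powr (p' / q' - 1))) < \<infinity>)
       \<and> (nonatomic (restr_to_subalg M F) \<longrightarrow>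
            \<not> (\<exists>v :: 'a \<Rightarrow> 'k. v \<in> borel_measurable M
                  \<and> R_bounded M F p q v \<and> R_nonzero M F p v))
       \<and> (sets F = sets M \<longrightarrow>
            (\<forall>f :: 'a \<Rightarrow> 'k. f \<in> borel_measurable M \<longrightarrow> (AE x in M. cond_exp M F f x = f x))
          \<and> (bounded_Lp_Lq M p q (\<lambda>f x. u x * f x) \<longleftrightarrow>
                (AE x in M. x \<in> B \<longrightarrow> u x = 0)
              \<and> (SUP n\<in>I. ennreal (norm (atom_value M (A n) u)
                            / measure M (A n) powr (1 / q' - 1 / p'))) < \<infinity>))"
proof -
  interpret sigma_finite_subalgebra M F
    by (intro sigma_finite_subalgebra.intro assms(2,3))
  note cover = assms(4) and at = assms(5) and B = assms(7) and nonat = assms(9)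
    and p = assms(10,11,12) and q = assms(13) and u[measurable] = assms(14)
  have I: "countable I" by (rule countableI_type)
  have p': "1 < p'" using conjugate_exponent_gt_1 p by blast
  define w where "w y = ennreal (norm (u y) powr p')" for y
  have w[measurable]: "w \<in> borel_measurable M" unfolding w_def by measurable
  have w_eq: "(\<lambda>y. ennreal (norm (u y) powr p')) = w" by (simp add: w_def fun_eq_iff)
  have w0: "w x = 0 \<longleftrightarrow> u x = 0" for x by (cases "u x = 0") (simp_all add: w_def ennreal_eq_0_iff not_le)
  have bdd: "R_bounded M F p q u \<longleftrightarrow> (AE x in M. x \<in> B \<longrightarrow> u x = 0) \<and>
    (\<exists>K\<ge>0. \<forall>n\<in>I. (\<integral>\<^sup>+x\<in>A n. w x \<partial>M) \<le> ennreal (K * measure M (A n) powr (p' / q')))"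
    unfolding w_def by (rule R_bounded_iff[OF cover I at B nonat u p q])
  have zero: "(AE x in M. x \<in> B \<longrightarrow> nn_cond_exp M F w x = 0) \<longleftrightarrow> (AE x in M. x \<in> B \<longrightarrow> u x = 0)"
    using nn_cond_exp_zero_on_iff[OF B w] by (simp add: w0)
  have sup: "(SUP n\<in>I. atom_value M (A n) (nn_cond_exp M F w) / ennreal (measure M (A n) powr (p' / q' - 1))) < \<infinity>
    \<longleftrightarrow> (\<exists>K\<ge>0. \<forall>n\<in>I. (\<integral>\<^sup>+x\<in>A n. w x \<partial>M) \<le> ennreal (K * measure M (A n) powr (p' / q')))"
    by (rule SUP_atom_value_nn_cond_exp_finite_iff[OF at w])
  have "\<not> (\<exists>v :: 'a \<Rightarrow> 'k. v \<in> borel_measurable M \<and> R_bounded M F p q v \<and> R_nonzero M F p v)"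
    if na: "nonatomic (restr_to_subalg M F)"
  proof
    assume "\<exists>v :: 'a \<Rightarrow> 'k. v \<in> borel_measurable M \<and> R_bounded M F p q v \<and> R_nonzero M F p v"
    then obtain v :: "'a \<Rightarrow> 'k" where v: "v \<in> borel_measurable M" "R_bounded M F p q v" "R_nonzero M F p v"
      by blast
    \<comment> \<open>Without atoms in \<open>F\<close> the whole space can take the place of
      \<open>B\<close>, so \<open>v\<close> vanishes a.e. and every \<open>R_op M F v f\<close> with
      it.\<close>
    have sp: "space M \<in> sets F" using subalg by (metis sets.top subalgebra_def)
    then have "nonatomic (restrict_space (restr_to_subalg M F) (space M))"
      using na is_atom_restrict_space[of "space M" "restr_to_subalg M F"]
      by (auto simp: nonatomic_def sets_restr_to_subalg[OF subalg])
    then have "AE x in M. x \<in> space M \<longrightarrow> v x = 0"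
      by (rule R_bounded_imp_zero_on_nonatomic[OF v(2,1) p q sp])
    then have "AE x in M. v x = 0" using AE_space by eventually_elim auto
    then have "AE x in M. R_op M F v f x = 0" if "f \<in> Lp_space M p" for f
      using R_op_eq_0[OF v(1)] that by (auto simp: Lp_space_def)
    then show False using v(3) by (auto simp: R_nonzero_def)
  qed
  moreover have "(\<forall>f :: 'a \<Rightarrow> 'k. f \<in> borel_measurable M \<longrightarrow> (AE x in M. cond_exp M F f x = f x))
      \<and> (bounded_Lp_Lq M p q (\<lambda>f x. u x * f x) \<longleftrightarrow>
            (AE x in M. x \<in> B \<longrightarrow> u x = 0)
          \<and> (SUP n\<in>I. ennreal (norm (atom_value M (A n) u)
                        / measure M (A n) powr (1 / q' - 1 / p'))) < \<infinity>)"
    if eq: "sets F = sets M"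
  proof -
    have "(SUP n\<in>I. ennreal (norm (atom_value M (A n) u) / measure M (A n) powr (1 / q' - 1 / p'))) < \<infinity>
      \<longleftrightarrow> (\<exists>K\<ge>0. \<forall>n\<in>I. (\<integral>\<^sup>+x\<in>A n. w x \<partial>M) \<le> ennreal (K * measure M (A n) powr (p' / q')))"
      unfolding w_def using p' by (intro SUP_norm_atom_value_finite_iff[OF eq u at]) auto
    then show ?thesis
      using cond_exp_eq_self[OF eq] R_bounded_iff_mult_bounded[OF eq u] bdd by blast
  qed
  ultimately show ?thesis unfolding w_eq zero sup using bdd by blast
qed

end
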